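(* Let $R=R(X,S_1,S_2)$ be a reduced extended affine root system of type $X$, nullity $\nu$ and twist number $t$. (i) If $X=B_\ell$ ($\ell\ge2$) and $S_1$ satisfies one of the following conditions, then $R$ is not minimal: (a) there exists $J\in\mathrm{Esupp}(S_1)$ such that $\{r,s\}\in\mathrm{supp}(S_1)$ for all $r,s\in J$; (b) $t\ge3$ and $S_1$ is a lattice; (c) $t>3$ and $\mathrm{ind}(S_1)=2^t-2$. (ii) If $X=C_\ell$ ($\ell\ge3$) and $S_2$ satisfies one of the following conditions, then $R$ is not minimal: (a) there exists $J\in\mathrm{Esupp}(S_2)$ such that $\{r,s\}\in\mathrm{supp}(S_2)$ for all $r,s\in J$; (b) $\nu-t\ge3$ and $S_2$ is a lattice; (c) $\nu-t>3$ and $\mathrm{ind}(S_2)=2^{\nu-t}-2$.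
   Context: A semilattice in a finite-dimensional real vector space $U$ is a discrete spanning subset $S\subseteq U$ with $0\in S$ and $S=S\pm2S$; $\langle S\rangle$ is its $\mathbb Z$-span, and $S$ is a lattice if $S=\langle S\rangle$. A reduced extended affine root system of type $X=B_\ell$ ($\ell\ge2$) or $C_\ell$ ($\ell\ge3$), nullity $\nu$ and twist number $t$ is described as follows: $\mathcal V=\dot{\mathcal V}\oplus\mathcal V^0$ is a real vector space with a positive semidefinite symmetric bilinear form with radical $\mathcal V^0=\mathcal V_1^0\oplus\mathcal V_2^0$, $\dim\mathcal V^0_1=t$, $\dim\mathcal V^0_2=\nu-t$; $\dot R=\{0\}\cup\dot R_{sh}\cup\dot R_{lg}$ is a finite root system of type $X$ spanning $\dot{\mathcal V}$ (short and long roots); $S_i$ is a semilattice in $\mathcal V_i^0$ ($i=1,2$), $S_2$ being a lattice if $X=B_\ell$ with $\ell\ge3$ and $S_1$ being a lattice if $X=C_\ell$ with $\ell\ge3$; with $S=S_1\oplus\langle S_2\rangle$, $R=R(X,S_1,S_2)=(S+S)\cup(\dot R_{sh}+S_1\oplus\langle S_2\rangle)\cup(\dot R_{lg}+2\langle S_1\rangle\oplus S_2)$. Fix $\sigma_1,\dots,\sigma_t\in S_1$ forming a $\mathbb Z$-basis of $\langle S_1\rangle$ and $\sigma_{t+1},\dots,\sigma_\nu\in S_2$ forming a $\mathbb Z$-basis of $\langle S_2\rangle$. $\mathrm{supp}(S_1)=\{J\subseteq\{1,\dots,t\}:\sum_{r\in J}\sigma_r\in S_1\}$, $\mathrm{supp}(S_2)=\{J\subseteq\{t+1,\dots,\nu\}:\sum_{r\in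 J}\sigma_r\in S_2\}$, $\mathrm{Esupp}(S_j)=\{J\in\mathrm{supp}(S_j):|J|\ge3\}$, $\mathrm{ind}(S_j)=|\mathrm{supp}(S_j)|-1$. $R^\times=\{\alpha\in R:(\alpha,\alpha)\neq0\}$, $\alpha^\vee=2\alpha/(\alpha,\alpha)$. Let $\tilde{\mathcal V}=\mathcal V\oplus(\mathcal V^0)^*$ with the form extended by $(\dot\beta_1+\delta_1+\lambda_1,\dot\beta_2+\delta_2+\lambda_2)=(\dot\beta_1,\dot\beta_2)+\lambda_1(\delta_2)+\lambda_2(\delta_1)$ for $\dot\beta_i\in\dot{\mathcal V}$, $\delta_i\in\mathcal V^0$, $\lambda_i\in(\mathcal V^0)^*$. The Weyl group $\mathcal W$ is the subgroup of $GL(\tilde{\mathcal V})$ generated by $w_\alpha(u)=u-(u,\alpha^\vee)\alpha$, $\alpha\in R^\times$. $R$ is minimal if there is no $\alpha\in R^\times$ such that the reflections $w_\beta$, $\beta\in R^\times\setminus\mathcal W\alpha$, generate $\mathcal W$. *)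

theory Defs
  imports "HOL-Analysis.Analysis" "HOL-Algebra.Generated_Groups"
begin

section \<open>Semilattices\<close>

abbreviation int_scale :: "int \<Rightarrow> 'a::real_vector \<Rightarrow> 'a"
  where "int_scale k x \<equiv> of_int k *\<^sub>R x"

lemma module_int_scale: "module (int_scale :: int \<Rightarrow> 'a::real_vector \<Rightarrow> 'a)"
  by unfold_locales (simp_all add: algebra_simps)

definition zspan :: "'a::real_vector set \<Rightarrow> 'a set"
  where "zspan A = module.span int_scale A"

definition zindependent :: "'a::real_vector set \<Rightarrow> bool"
  where "zindependent A \<longleftrightarrow> \<not> module.dependent int_scale A"

text \<open>Sums of subsets are the elementwise sums of \<^theory>\<open>HOL-Library.Set_Algebras\<close>.
  The ambient space is the whole type, which may be the zero space.\<close>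

definition semilattice_set :: "'a::real_normed_vector set \<Rightarrow> bool"
  where "semilattice_set S \<longleftrightarrow>
    discrete S \<and> span S = UNIV \<and> 0 \<in> S \<and>
    S = (S + (\<lambda>x. 2 *\<^sub>R x) ` S) \<union> (S + (\<lambda>x. - (2 *\<^sub>R x)) ` S)"

definition is_lattice :: "'a::real_normed_vector set \<Rightarrow> bool"
  where "is_lattice S \<longleftrightarrow> semilattice_set S \<and> S = zspan S"

definition zbasis_in :: "nat set \<Rightarrow> (nat \<Rightarrow> 'a::real_vector) \<Rightarrow> 'a set \<Rightarrow> bool"
  where "zbasis_in I \<sigma> S \<longleftrightarrow>
    (\<forall>i\<in>I. \<sigma> i \<in> S) \<and> inj_on \<sigma> I \<and> zindependent (\<sigma> ` I) \<and> zspan (\<sigma> ` I) = zspan S"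

definition supp :: "nat set \<Rightarrow> (nat \<Rightarrow> 'a::real_vector) \<Rightarrow> 'a set \<Rightarrow> nat set set"
  where "supp I \<sigma> S = {J. J \<subseteq> I \<and> (\<Sum>r\<in>J. \<sigma> r) \<in> S}"

definition Esupp :: "nat set \<Rightarrow> (nat \<Rightarrow> 'a::real_vector) \<Rightarrow> 'a set \<Rightarrow> nat set set"
  where "Esupp I \<sigma> S = {J \<in> supp I \<sigma> S. card J \<ge> 3}"

definition ind :: "nat set \<Rightarrow> (nat \<Rightarrow> 'a::real_vector) \<Rightarrow> 'a set \<Rightarrow> nat"
  where "ind I \<sigma> S = card (supp I \<sigma> S) - 1"


section \<open>Finite root systems of type B and C\<close>

text \<open>Root systems contain \<open>0\<close>; the invariant form is the inner product of the type.\<close>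

definition finite_root_system :: "'d::euclidean_space set \<Rightarrow> bool"
  where "finite_root_system \<Phi> \<longleftrightarrow>
    finite \<Phi> \<and> 0 \<in> \<Phi> \<and> span \<Phi> = UNIV \<and>
    (\<forall>\<alpha>\<in>\<Phi> - {0}. \<forall>\<beta>\<in>\<Phi>.
       2 * (\<beta> \<bullet> \<alpha>) / (\<alpha> \<bullet> \<alpha>) \<in> \<int> \<and> \<beta> - (2 * (\<beta> \<bullet> \<alpha>) / (\<alpha> \<bullet> \<alpha>)) *\<^sub>R \<alpha> \<in> \<Phi>) \<and>
    (\<forall>\<alpha>\<in>\<Phi> - {0}. \<forall>c. c *\<^sub>R \<alpha> \<in> \<Phi> - {0} \<longrightarrow> c = 1 \<or> c = - 1)"

datatype root_type = TypeB | TypeC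

definition pm_roots :: "nat \<Rightarrow> (nat \<Rightarrow> 'd::real_vector) \<Rightarrow> 'd set"
  where "pm_roots l e =
    {a *\<^sub>R e i + b *\<^sub>R e j | a b i j. a \<in> {1, -1} \<and> b \<in> {1, -1} \<and> 1 \<le> i \<and> i < j \<and> j \<le> l}"

fun standard_roots :: "root_type \<Rightarrow> nat \<Rightarrow> (nat \<Rightarrow> 'd::real_vector) \<Rightarrow> 'd set"
  where
    "standard_roots TypeB l e =
       {0} \<union> {a *\<^sub>R e i | a i. a \<in> {1, -1} \<and> i \<in> {1..l}} \<union> pm_roots l e"
  | "standard_roots TypeC l e =
       {0} \<union> {(2 * a) *\<^sub>R e i | a i. a \<in> {1, -1} \<and> i \<in> {1..l}} \<union> pm_roots l e"

text \<open>A root system has type \<open>X\<^sub>l\<close> if it is isomorphic to the standard (Bourbaki) model;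
  isomorphisms of irreducible root systems are similarities, so the images \<open>e\<close> of the
  coordinate vectors are orthogonal of one common, but arbitrary, length.\<close>

definition has_root_type :: "root_type \<Rightarrow> nat \<Rightarrow> 'd::euclidean_space set \<Rightarrow> bool"
  where "has_root_type X l \<Phi> \<longleftrightarrow> finite_root_system \<Phi> \<and>
    (\<exists>e c. c > 0 \<and> (\<forall>i\<in>{1..l}. \<forall>j\<in>{1..l}. e i \<bullet> e j = (if i = j then c else 0)) \<and>
           span (e ` {1..l}) = UNIV \<and> \<Phi> = standard_roots X l e)"

definition short_roots :: "'d::euclidean_space set \<Rightarrow> 'd set"
  where "short_roots \<Phi> = {\<alpha> \<in> \<Phi> - {0}. \<forall>\<beta>\<in>\<Phi> - {0}. \<alpha> \<bullet> \<alpha> \<le> \<beta> \<bullet> \<beta>}"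

definition long_roots :: "'d::euclidean_space set \<Rightarrow> 'd set"
  where "long_roots \<Phi> = {\<alpha> \<in> \<Phi> - {0}. \<forall>\<beta>\<in>\<Phi> - {0}. \<beta> \<bullet> \<beta> \<le> \<alpha> \<bullet> \<alpha>}"


section \<open>Extended affine root systems of type B and C\<close>

text \<open>The orthogonal sum of the span of the finite root system and the two summands of the
  radical is the product type \<open>'d \<times> ('a \<times> 'b)\<close>.  The summands \<open>'a\<close> and \<open>'b\<close> are normed spaces,
  required to be finite-dimensional, rather than Euclidean spaces, because either may have
  dimension zero; the norms only serve to provide the canonical topology.\<close>

definition V_form :: "'d::euclidean_space \<times> 'z \<Rightarrow> 'd \<times> 'z \<Rightarrow> real"
  where "V_form x y = fst x \<bullet> fst y"

definition root_set ::
  "'d::euclidean_space set \<Rightarrow> 'a::real_normed_vector set \<Rightarrow> 'b::real_normed_vector set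
     \<Rightarrow> ('d \<times> ('a \<times> 'b)) set"
  where "root_set \<Phi> S1 S2 =
    {0} \<times> ((S1 \<times> zspan S2) + (S1 \<times> zspan S2)) \<union>
    short_roots \<Phi> \<times> (S1 \<times> zspan S2) \<union>
    long_roots \<Phi> \<times> ((\<lambda>x. 2 *\<^sub>R x) ` zspan S1 \<times> S2)"

locale reduced_ears =
  fixes X :: root_type and l \<nu> t :: nat
    and \<Phi> :: "'d::euclidean_space set"
    and S1 :: "'a::real_normed_vector set"
    and S2 :: "'b::real_normed_vector set"
  assumes rank: "(X = TypeB \<and> l \<ge> 2) \<or> (X = TypeC \<and> l \<ge> 3)"
    and root_type: "has_root_type X l \<Phi>"
    and twist_le: "t \<le> \<nu>"
    and fin_dim1: "\<exists>B::'a set. finite B \<and> span B = UNIV"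
    and fin_dim2: "\<exists>B::'b set. finite B \<and> span B = UNIV"
    and dim1: "dim (UNIV :: 'a set) = t"
    and dim2: "dim (UNIV :: 'b set) = \<nu> - t"
    and semilattice1: "semilattice_set S1"
    and semilattice2: "semilattice_set S2"
    and lattice2: "X = TypeB \<and> l \<ge> 3 \<Longrightarrow> is_lattice S2"
    and lattice1: "X = TypeC \<Longrightarrow> is_lattice S1"


section \<open>Weyl group and minimality\<close>

definition nonisotropic :: "('d::euclidean_space \<times> 'z) set \<Rightarrow> ('d \<times> 'z) set"
  where "nonisotropic R = {\<alpha> \<in> R. V_form \<alpha> \<alpha> \<noteq> 0}"

definition coroot :: "'d::euclidean_space \<times> 'z::real_vector \<Rightarrow> 'd \<times> 'z"
  where "coroot \<alpha> = (2 / V_form \<alpha> \<alpha>) *\<^sub>R \<alpha>"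

text \<open>In finite dimension every linear functional is bounded, so \<open>'z \<Rightarrow>\<^sub>L real\<close> is the full
  dual space of the radical \<open>'z\<close>.\<close>

type_synonym ('d, 'z) extended = "('d \<times> 'z) \<times> ('z \<Rightarrow>\<^sub>L real)"

definition ext_form ::
  "('d::euclidean_space, 'z::real_normed_vector) extended \<Rightarrow> ('d, 'z) extended \<Rightarrow> real"
  where "ext_form u v =
    fst (fst u) \<bullet> fst (fst v)
      + blinfun_apply (snd u) (snd (fst v)) + blinfun_apply (snd v) (snd (fst u))"

definition embed ::
  "'d::euclidean_space \<times> 'z::real_normed_vector \<Rightarrow> ('d, 'z) extended"
  where "embed x = (x, 0)"

definition reflection ::
  "'d::euclidean_space \<times> 'z::real_normed_vector \<Rightarrow> ('d, 'z) extended \<Rightarrow> ('d, 'z) extended"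
  where "reflection \<alpha> u = u - ext_form u (embed (coroot \<alpha>)) *\<^sub>R embed \<alpha>"

definition GL :: "('v::real_vector \<Rightarrow> 'v) monoid"
  where "GL = \<lparr>carrier = {f. linear f \<and> bij f}, mult = (\<circ>), one = id\<rparr>"

definition weyl_group ::
  "('d::euclidean_space \<times> 'z::real_normed_vector) set
     \<Rightarrow> (('d, 'z) extended \<Rightarrow> ('d, 'z) extended) set"
  where "weyl_group R = generate GL (reflection ` nonisotropic R)"

definition minimal_ears :: "('d::euclidean_space \<times> 'z::real_normed_vector) set \<Rightarrow> bool"
  where "minimal_ears R \<longleftrightarrow>
    \<not> (\<exists>\<alpha>\<in>nonisotropic R.
         generate GL (reflection `
           {\<beta> \<in> nonisotropic R. embed \<beta> \<notin> (\<lambda>w. w (embed \<alpha>)) ` weyl_group R})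
         = weyl_group R)"

end

theory Submission
  imports Defs
begin

text \<open>
  Call the short roots in type \<open>B\<close>, and the long roots in type \<open>C\<close>, the \<^emph>\<open>critical\<close> roots,
  and let \<open>S\<close> be \<open>S1\<close> or \<open>S2\<close> accordingly.  The radical component in \<open>\<langle>S\<rangle>\<close> of a critical root
  \<open>\<beta>\<close> is constant modulo \<open>2\<langle>S\<rangle>\<close> along its Weyl orbit: reflecting \<open>\<beta>\<close> in \<open>\<gamma>\<close> subtracts an
  integral multiple of \<open>\<gamma>\<close>, and either that integer is even or \<open>\<gamma>\<close> is a long root of type \<open>B\<close>,
  whose component lies in \<open>2\<langle>S1\<rangle>\<close> anyway.  So the orbit of \<open>\<alpha> = e + \<sigma>\<^sub>J\<close>, where
  \<open>\<sigma>\<^sub>J = (\<Sum>r\<in>J. \<sigma> r)\<close>, meets no critical root whose component is in another class, in particular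
  none with component \<open>0\<close>, \<open>\<sigma> r\<close> or \<open>\<sigma> r + \<sigma> s\<close> for \<open>r, s \<in> J\<close>, because \<open>J\<close> has at least
  three elements and the \<open>\<sigma> r\<close> are independent over the integers.

  The reflections in those remaining roots already produce the removed ones.  Fix \<open>e\<close>, write
  \<open>w\<^sub>s\<close> for the reflection in \<open>e + s\<close> and put \<open>T\<^sub>s = w\<^sub>s w\<^sub>0\<close>.  On the extended space these
  translations satisfy a Heisenberg relation \<open>T\<^sub>s T\<^sub>t = C(s, t) T\<^bsub>s+t\<^esub>\<close> with \<open>C(s, t)\<close> central,
  biadditive and alternating.  If all pairwise sums \<open>\<sigma> r + \<sigma> s\<close> are available then every
  \<open>C(\<sigma> r, \<sigma> s)\<close> is a product of available reflections, hence so is every central correction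
  between \<open>T\<^bsub>\<sigma>\<^sub>J\<^esub>\<close> and the product of the \<open>T\<^bsub>\<sigma> r\<^esub>\<close>, and therefore so is \<open>w\<^bsub>\<sigma>\<^sub>J\<^esub>\<close>
  (\<open>reflection_sum\<close>).  An arbitrary root of the orbit differs from \<open>e + \<sigma>\<^sub>J\<close> by an element that
  can be absorbed into a single summand \<open>\<sigma> r\<close> without changing any class, so the same argument
  covers it (\<open>not_minimal_if_class_removable\<close>).

  This is condition (a).  Conditions (b) and (c) imply it: in a lattice every subset of the basis
  is supported, and if exactly one subset \<open>J0\<close> is unsupported then any three indices chosen away
  from one element of \<open>J0\<close> have all their subsets supported (\<open>pairwise_supported_Esupp\<close>).
\<close>

section \<open>Reflections and the groups they generate\<close>

lemma reflection_apply:
  assumes "c = 2 / (e \<bullet> e)"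
  shows "reflection (e, s) ((u, z), f) =
     ((u - (c * (u \<bullet> e + blinfun_apply f s)) *\<^sub>R e,
       z - (c * (u \<bullet> e + blinfun_apply f s)) *\<^sub>R s), f)"
  using assms
  by (simp add: reflection_def ext_form_def embed_def coroot_def V_form_def blinfun.scaleR_right
      ring_distribs)

text \<open>The scalar \<open>m\<close> stands for the pairing with the root that occurs in \<open>reflection_apply\<close>.
  Treating it as opaque lets compositions of reflections be computed without clearing the
  denominator \<open>e \<bullet> e\<close>.\<close>

lemma inner_reflected:
  assumes "c = 2 / (e \<bullet> e)" and "e \<noteq> 0"
  shows "(u - (c * m) *\<^sub>R e) \<bullet> e = u \<bullet> e - 2 * m"
  using assms by (simp add: inner_diff_left)

lemma reflection_embed:
  "reflection \<gamma> (embed \<beta>) =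
     embed (\<beta> - (2 * (fst \<beta> \<bullet> fst \<gamma>) / (fst \<gamma> \<bullet> fst \<gamma>)) *\<^sub>R \<gamma>)"
  by (cases \<gamma>; cases \<beta>) (simp add: embed_def reflection_apply[OF refl])

lemma reflection_involutive: "reflection \<alpha> (reflection \<alpha> u) = u"
proof -
  obtain e s where \<alpha>: "\<alpha> = (e, s)" by fastforce
  obtain v z f where u: "u = ((v, z), f)" by (metis prod.collapse)
  define c where "c = 2 / (e \<bullet> e)"
  show ?thesis
  proof (cases "e = 0")
    case True
    then show ?thesis by (simp add: \<alpha> u reflection_apply[OF refl])
  next
    case False
    then show ?thesis
      by (simp add: \<alpha> u reflection_apply[OF c_def] inner_reflected[OF c_def])
         (simp add: algebra_simps flip: scaleR_add_left)
  qed
qed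

lemma linear_reflection: "linear (reflection \<alpha>)"
proof -
  obtain e s where \<alpha>: "\<alpha> = (e, s)" by fastforce
  define c where "c = 2 / (e \<bullet> e)"
  show ?thesis
    by (rule linearI)
       (auto simp: \<alpha> reflection_apply[OF c_def] blinfun.add_left blinfun.scaleR_left
         algebra_simps inner_add_left)
qed

lemma reflection_in_GL: "reflection \<alpha> \<in> carrier GL"
  by (auto simp: GL_def linear_reflection intro: involuntory_imp_bij reflection_involutive)

lemma monoid_GL: "monoid GL"
  by unfold_locales (auto simp: GL_def bij_comp linear_compose linear_id comp_assoc)

lemma inv_reflection: "inv\<^bsub>GL\<^esub> (reflection \<alpha>) = reflection \<alpha>"
proof -
  have "reflection \<alpha> \<otimes>\<^bsub>GL\<^esub> reflection \<alpha> = \<one>\<^bsub>GL\<^esub>"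
    by (auto simp: GL_def reflection_involutive fun_eq_iff)
  then show ?thesis
    using monoid.inv_unique'[OF monoid_GL reflection_in_GL reflection_in_GL] by metis
qed

text \<open>Reflections are their own inverses, so a set containing them needs closure only under
  composition to contain the whole group.  This serves both for comparing two reflection groups
  and for propagating invariants of orbits.\<close>

lemma generate_reflections_subset:
  assumes "id \<in> G" "\<And>g h. g \<in> G \<Longrightarrow> h \<in> G \<Longrightarrow> g \<circ> h \<in> G"
    and "\<And>\<alpha>. \<alpha> \<in> A \<Longrightarrow> reflection \<alpha> \<in> G"
  shows "generate GL (reflection ` A) \<subseteq> G"
proof
  fix w assume "w \<in> generate GL (reflection ` A)"
  then show "w \<in> G"
  proof (induction rule: generate.induct)
    case one
    then show ?case using assms(1) by (simp add: GL_def id_def)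
  next
    case (incl h)
    then show ?case using assms(3) by blast
  next
    case (inv h)
    then show ?case using assms(3) by (auto simp: inv_reflection)
  next
    case (eng h1 h2)
    then show ?case using assms(2)[OF eng.IH] by (simp add: GL_def comp_def)
  qed
qed

lemma generate_GL_id: "id \<in> generate GL A"
  using generate.one[of GL A] by (simp add: GL_def)

lemma generate_GL_comp:
  "g \<in> generate GL A \<Longrightarrow> h \<in> generate GL A \<Longrightarrow> g \<circ> h \<in> generate GL A"
  using generate.eng[of g GL A h] by (simp add: GL_def)

section \<open>The Heisenberg relation between reflections along one direction\<close>

text \<open>With \<open>c = 2 / (e \<bullet> e)\<close> this is the central factor \<open>C(s, t)\<close> by which \<open>T\<^sub>s T\<^sub>t\<close> differs from
  \<open>T\<^bsub>s+t\<^esub>\<close>, where \<open>T\<^sub>s\<close> is the product of the reflections in \<open>(e, s)\<close> and \<open>(e, 0)\<close>.  It moves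
  vectors only by radical vectors, depends on \<open>e\<close> only through \<open>c\<close>, and is alternating in \<open>s\<close> and \<open>t\<close>.\<close>

definition central_shear ::
  "real \<Rightarrow> 'z \<Rightarrow> 'z \<Rightarrow> ('d::euclidean_space, 'z::real_normed_vector) extended \<Rightarrow> ('d, 'z) extended"
  where "central_shear c s t u =
    ((fst (fst u), snd (fst u) + c *\<^sub>R (snd u s *\<^sub>R t - snd u t *\<^sub>R s)), snd u)"

lemma central_shear_zero: "central_shear c 0 t = id"
  by (auto simp: central_shear_def fun_eq_iff)

lemma central_shear_add:
  "central_shear c (s + s') t = central_shear c s t \<circ> central_shear c s' t"
  by (auto simp: central_shear_def fun_eq_iff blinfun.add_right algebra_simps)

text \<open>This is \<open>C(s, t) = T\<^sub>s T\<^sub>t T\<^bsub>s+t\<^esub>\<inverse>\<close>, with the two middle copies of the reflection in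
  \<open>(e, 0)\<close> cancelled: a central factor becomes available once \<open>s\<close>, \<open>t\<close> and \<open>s + t\<close> are.\<close>

lemma central_shear_reflections:
  fixes e :: "'d::euclidean_space" and s t :: "'z::real_normed_vector"
  assumes "e \<noteq> 0"
  shows "central_shear (2 / (e \<bullet> e)) s t =
    reflection (e, s) \<circ> reflection (e, 0) \<circ> reflection (e, t) \<circ> reflection (e, s + t)"
proof
  fix u :: "('d, 'z) extended"
  define c where "c = 2 / (e \<bullet> e)"
  obtain v z f where u: "u = ((v, z), f)" by (metis prod.collapse)
  show "central_shear (2 / (e \<bullet> e)) s t u = (reflection (e, s) \<circ> reflection (e, 0) \<circ>
      reflection (e, t) \<circ> reflection (e, s + t)) u"
    using assms unfolding c_def[symmetric]
    by (simp add: u central_shear_def reflection_apply[OF c_def] inner_reflected[OF c_def]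
        blinfun.add_right)
       (simp add: algebra_simps, simp flip: scaleR_add_left)
qed

text \<open>The same relation solved for the reflection in \<open>(e, s + t)\<close>, using \<open>C(s, t)\<inverse> = C(t, s)\<close>.\<close>

lemma reflection_add:
  fixes e :: "'d::euclidean_space" and s t :: "'z::real_normed_vector"
  assumes "e \<noteq> 0"
  shows "reflection (e, s + t) =
    central_shear (2 / (e \<bullet> e)) t s \<circ> reflection (e, s) \<circ> reflection (e, 0) \<circ> reflection (e, t)"
proof
  fix u :: "('d, 'z) extended"
  define c where "c = 2 / (e \<bullet> e)"
  obtain v z f where u: "u = ((v, z), f)" by (metis prod.collapse)
  show "reflection (e, s + t) u = (central_shear (2 / (e \<bullet> e)) t s \<circ> reflection (e, s) \<circ>
      reflection (e, 0) \<circ> reflection (e, t)) u"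
    using assms unfolding c_def[symmetric]
    by (simp add: u central_shear_def reflection_apply[OF c_def] inner_reflected[OF c_def]
        blinfun.add_right)
       (simp add: algebra_simps, simp flip: scaleR_add_left)
qed

text \<open>Sums of two summands suffice to reach sums of arbitrarily many: when one more summand
  \<open>x r\<close> is added, the correction \<open>C(\<Sum>s\<in>F. x s, x r)\<close> splits by additivity into factors
  \<open>C(x s, x r)\<close>, each of which involves only a pair.\<close>

lemma reflection_sum:
  assumes id: "id \<in> G" and comp: "\<And>g h. g \<in> G \<Longrightarrow> h \<in> G \<Longrightarrow> g \<circ> h \<in> G"
    and "e \<noteq> 0" and "finite J"
    and zero: "reflection (e, 0) \<in> G"
    and single: "\<And>r. r \<in> J \<Longrightarrow> reflection (e, x r) \<in> G"
    and pair: "\<And>r s. r \<in> J \<Longrightarrow> s \<in> J \<Longrightarrow> r \<noteq> s \<Longrightarrow> reflection (e, x r + x s) \<in> G"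
  shows "reflection (e, \<Sum>r\<in>J. x r) \<in> G"
  using \<open>finite J\<close> single pair
proof (induction J)
  case empty
  then show ?case using zero by simp
next
  case (insert r F)
  let ?C = "central_shear (2 / (e \<bullet> e))"
  have C_single: "?C (x s) (x r) \<in> G" if "s \<in> F" for s
    using that insert.hyps insert.prems zero
    by (auto simp: central_shear_reflections[OF \<open>e \<noteq> 0\<close>] intro!: comp)
  have "?C (\<Sum>s\<in>F'. x s) (x r) \<in> G" if "finite F'" "F' \<subseteq> F" for F'
    using that by (induction F' rule: finite_induct) (auto simp: central_shear_zero central_shear_add id intro!: comp C_single)
  then have "?C (\<Sum>s\<in>F. x s) (x r) \<in> G"
    using insert.hyps by blast
  moreover have "reflection (e, \<Sum>s\<in>F. x s) \<in> G"
    using insert.IH insert.prems by blast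
  ultimately show ?case
    unfolding sum.insert[OF insert.hyps] reflection_add[OF \<open>e \<noteq> 0\<close>]
    using insert.prems(1) zero by (intro comp) auto
qed

section \<open>A criterion for non-minimality\<close>

text \<open>Here \<open>E\<close> is the set of critical finite roots, \<open>L\<close> the set of radical components above
  each of them, and \<open>M\<close> the subgroup of the radical modulo which these components are invariant
  under the Weyl group; the assumption \<open>stable\<close> expresses this invariance.  The class to be
  removed is that of \<open>\<Sum>r\<in>J. x r\<close>.\<close>

lemma not_minimal_if_class_removable:
  fixes R :: "('d::euclidean_space \<times> 'z::real_normed_vector) set"
  assumes EL: "E \<times> L \<subseteq> nonisotropic R" and "e0 \<in> E"
    and M0: "0 \<in> M" and Madd: "\<And>a b. a \<in> M \<Longrightarrow> b \<in> M \<Longrightarrow> a + b \<in> M"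
    and Mminus: "\<And>a. a \<in> M \<Longrightarrow> - a \<in> M"
    and LM: "\<And>a b. a \<in> L \<Longrightarrow> b \<in> M \<Longrightarrow> a + b \<in> L"
    and "finite J" "J \<noteq> {}"
    and sumL: "(\<Sum>r\<in>J. x r) \<in> L"
    and zero: "0 \<in> L" "(\<Sum>r\<in>J. x r) \<notin> M"
    and single: "\<And>r. r \<in> J \<Longrightarrow> x r \<in> L \<and> x r - (\<Sum>r\<in>J. x r) \<notin> M"
    and pair: "\<And>r s. r \<in> J \<Longrightarrow> s \<in> J \<Longrightarrow> r \<noteq> s \<Longrightarrow>
      x r + x s \<in> L \<and> x r + x s - (\<Sum>r\<in>J. x r) \<notin> M"
    and stable: "\<And>e \<gamma>. e \<in> E \<Longrightarrow> \<gamma> \<in> nonisotropic R \<Longrightarrow>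
      e - (2 * (e \<bullet> fst \<gamma>) / (fst \<gamma> \<bullet> fst \<gamma>)) *\<^sub>R fst \<gamma> \<in> E \<and>
      (2 * (e \<bullet> fst \<gamma>) / (fst \<gamma> \<bullet> fst \<gamma>)) *\<^sub>R snd \<gamma> \<in> M"
  shows "\<not> minimal_ears R"
proof -
  define y where "y = (\<Sum>r\<in>J. x r)"
  define P where "P = {(e, s). e \<in> E \<and> s - y \<in> M}"
  define \<alpha> where "\<alpha> = (e0, y)"
  define B where "B = {\<beta> \<in> nonisotropic R. embed \<beta> \<notin> (\<lambda>w. w (embed \<alpha>)) ` weyl_group R}"
  define G where "G = generate GL (reflection ` B)"
  (* P is the class of roots that contains the orbit of \<alpha>; it may be larger than the orbit. *)
  have "weyl_group R \<subseteq> {w. w ` embed ` P \<subseteq> embed ` P}"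
    unfolding weyl_group_def
  proof (rule generate_reflections_subset)
    fix \<gamma> assume \<gamma>: "\<gamma> \<in> nonisotropic R"
    have "\<beta> - (2 * (fst \<beta> \<bullet> fst \<gamma>) / (fst \<gamma> \<bullet> fst \<gamma>)) *\<^sub>R \<gamma> \<in> P" if "\<beta> \<in> P" for \<beta>
    proof -
      obtain e s where \<beta>: "\<beta> = (e, s)" "e \<in> E" "s - y \<in> M"
        using \<open>\<beta> \<in> P\<close> by (auto simp: P_def)
      let ?n = "2 * (e \<bullet> fst \<gamma>) / (fst \<gamma> \<bullet> fst \<gamma>)"
      have "s - y + - (?n *\<^sub>R snd \<gamma>) \<in> M"
        using stable[OF \<beta>(2) \<gamma>] \<beta>(3) by (intro Madd Mminus) auto
      then show ?thesis
        using stable[OF \<beta>(2) \<gamma>] by (cases \<gamma>) (auto simp: P_def \<beta>(1) algebra_simps)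
    qed
    then show "reflection \<gamma> \<in> {w. w ` embed ` P \<subseteq> embed ` P}"
      by (auto simp: reflection_embed)
  next
    fix g h
    assume "g \<in> {w. w ` embed ` P \<subseteq> embed ` P}" "h \<in> {w. w ` embed ` P \<subseteq> embed ` P}"
    then show "g \<circ> h \<in> {w. w ` embed ` P \<subseteq> embed ` P}"
      unfolding mem_Collect_eq image_comp[symmetric] by blast
  qed simp
  moreover have "\<alpha> \<in> P"
    using \<open>e0 \<in> E\<close> M0 by (simp add: \<alpha>_def P_def)
  ultimately have orbit: "(\<lambda>w. w (embed \<alpha>)) ` weyl_group R \<subseteq> embed ` P"
    by blast
  have embed_eq: "embed \<beta> = embed \<beta>' \<longleftrightarrow> \<beta> = \<beta>'" for \<beta> \<beta>' :: "'d \<times> 'z"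
    by (simp add: embed_def)
  have B: "(e, s) \<in> B" if "e \<in> E" "s \<in> L" "s - y \<notin> M" for e s
    using that EL orbit by (auto simp: B_def P_def embed_eq)
  have in_G: "reflection \<beta> \<in> G" if "\<beta> \<in> B" for \<beta>
    using that by (auto simp: G_def intro: generate.incl)
  have P_in_G: "reflection \<beta> \<in> G" if "\<beta> \<in> P" "\<beta> \<in> nonisotropic R" for \<beta>
  proof -
    obtain e s where \<beta>: "\<beta> = (e, s)" "e \<in> E" "s - y \<in> M"
      using \<open>\<beta> \<in> P\<close> by (auto simp: P_def)
    define m where "m = s - y"
    have "m \<in> M" using \<beta> by (simp add: m_def)
    have mod_M: "a + m \<in> L \<and> a + m - y \<notin> M" if "a \<in> L" "a - y \<notin> M" for a
    proof
      show "a + m \<in> L" using LM that \<open>m \<in> M\<close> by blast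
      show "a + m - y \<notin> M"
      proof
        assume "a + m - y \<in> M"
        from Madd[OF this Mminus[OF \<open>m \<in> M\<close>]] that(2) show False by simp
      qed
    qed
    (* The deviation m of s from y is absorbed into one summand; since m is in M, all single
       and pairwise sums stay in the classes they had before. *)
    obtain r0 where r0: "r0 \<in> J" using \<open>J \<noteq> {}\<close> by blast
    define x' where "x' = (\<lambda>r. x r + (if r = r0 then m else 0))"
    have "(\<Sum>r\<in>J. x' r) = s"
      using r0 \<open>finite J\<close> by (simp add: x'_def sum.distrib y_def[symmetric] m_def)
    moreover have "reflection (e, \<Sum>r\<in>J. x' r) \<in> G"
    proof (rule reflection_sum)
      show "id \<in> G" by (simp add: G_def generate_GL_id)
      show "g \<circ> h \<in> G" if "g \<in> G" "h \<in> G" for g h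
        using that by (simp add: G_def generate_GL_comp)
      show "e \<noteq> 0"
        using that(2) by (auto simp: \<beta>(1) nonisotropic_def V_form_def)
      show "finite J" by fact
      show "reflection (e, 0) \<in> G"
      proof (intro in_G B)
        show "0 - y \<notin> M" using Mminus[of "0 - y"] zero(2) by (auto simp: y_def)
      qed (use \<beta>(2) zero in auto)
      show "reflection (e, x' r) \<in> G" if "r \<in> J" for r
        using single[OF that] mod_M[of "x r"] \<beta>(2)
        by (intro in_G B) (auto simp: x'_def y_def)
      show "reflection (e, x' r + x' q) \<in> G" if "r \<in> J" "q \<in> J" "r \<noteq> q" for r q
      proof -
        have "x' r + x' q = x r + x q \<or> x' r + x' q = x r + x q + m"
          using that by (auto simp: x'_def algebra_simps)
        then show ?thesis
          using pair[OF that] mod_M[of "x r + x q"] \<beta>(2)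
          by (intro in_G B) (auto simp: y_def)
      qed
    qed
    ultimately show ?thesis by (simp add: \<beta>(1))
  qed
  have "\<alpha> \<in> nonisotropic R"
    using EL \<open>e0 \<in> E\<close> sumL by (auto simp: \<alpha>_def y_def)
  moreover have "G = weyl_group R"
  proof
    show "G \<subseteq> weyl_group R"
      unfolding G_def
      by (rule generate_reflections_subset)
         (auto simp: weyl_group_def generate_GL_id generate_GL_comp B_def intro: generate.incl)
    show "weyl_group R \<subseteq> G"
      unfolding weyl_group_def
    proof (rule generate_reflections_subset)
      fix \<beta> assume "\<beta> \<in> nonisotropic R"
      then show "reflection \<beta> \<in> G"
        using in_G P_in_G orbit by (cases "\<beta> \<in> B") (auto simp: B_def embed_eq)
    qed (auto simp: G_def generate_GL_id generate_GL_comp)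
  qed
  ultimately show ?thesis
    unfolding minimal_ears_def G_def B_def by blast
qed

section \<open>Semilattices modulo twice their integral span\<close>

lemmas zspan_zero = module.span_zero[OF module_int_scale, folded zspan_def]
  and zspan_add = module.span_add[OF module_int_scale, folded zspan_def]
  and zspan_minus = module.span_neg[OF module_int_scale, folded zspan_def]
  and zspan_scale = module.span_scale[OF module_int_scale, folded zspan_def]
  and zspan_base = module.span_base[OF module_int_scale, folded zspan_def]
  and zspan_sum = module.span_sum[OF module_int_scale, folded zspan_def]

lemma semilattice_add_double:
  assumes "semilattice_set S" and "z \<in> zspan S" and "s \<in> S"
  shows "s + 2 *\<^sub>R z \<in> S"
proof -
  have eq: "S = (S + (\<lambda>x. 2 *\<^sub>R x) ` S) \<union> (S + (\<lambda>x. - (2 *\<^sub>R x)) ` S)"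
    using assms(1) by (simp add: semilattice_set_def)
  have plus: "s + 2 *\<^sub>R x \<in> S" and minus: "s - 2 *\<^sub>R x \<in> S" if "s \<in> S" "x \<in> S" for s x
    using that by (subst eq, force simp: set_plus_def)+
  have multiple: "s + 2 *\<^sub>R (of_int k *\<^sub>R x) \<in> S" if "s \<in> S" "x \<in> S" for s x and k :: int
  proof (induction k rule: int_induct[where k = 0])
    case base
    then show ?case using that by simp
  next
    case (step1 i)
    from plus[OF step1(2) \<open>x \<in> S\<close>] show ?case by (simp add: algebra_simps)
  next
    case (step2 i)
    from minus[OF step2(2) \<open>x \<in> S\<close>] show ?case by (simp add: algebra_simps)
  qed
  have "\<forall>s\<in>S. s + 2 *\<^sub>R z \<in> S"
    using assms(2) unfolding zspan_def
  proof (induction rule: module.span_induct_alt[OF module_int_scale, consumes 1, case_names base step])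
    case base
    then show ?case by simp
  next
    case (step c x y)
    show ?case
    proof
      fix s assume "s \<in> S"
      then have "(s + 2 *\<^sub>R (of_int c *\<^sub>R x)) + 2 *\<^sub>R y \<in> S"
        using step multiple by blast
      then show "s + 2 *\<^sub>R (of_int c *\<^sub>R x + y) \<in> S" by (simp add: algebra_simps)
    qed
  qed
  then show ?thesis using assms(3) by blast
qed

text \<open>The subset sums of a basis represent the classes modulo twice the lattice without
  repetition, since the difference of two indicator vectors has all entries even only if it
  vanishes.\<close>

lemma subset_sum_parity_unique:
  assumes basis: "zbasis_in I \<sigma> S" and "finite I" and "F \<subseteq> I" "J \<subseteq> I"
    and "(\<Sum>r\<in>F. \<sigma> r) - (\<Sum>r\<in>J. \<sigma> r) \<in> (\<lambda>x. 2 *\<^sub>R x) ` zspan S"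
  shows "F = J"
proof -
  have inj: "inj_on \<sigma> I" and indep: "\<not> module.dependent int_scale (\<sigma> ` I)"
    and span: "zspan S = zspan (\<sigma> ` I)"
    using basis by (auto simp: zbasis_in_def zindependent_def)
  obtain z where z: "z \<in> zspan (\<sigma> ` I)"
    and diff: "(\<Sum>r\<in>F. \<sigma> r) - (\<Sum>r\<in>J. \<sigma> r) = 2 *\<^sub>R z"
    using assms(5) span by auto
  have "finite (\<sigma> ` I)" using \<open>finite I\<close> by simp
  then obtain u :: "_ \<Rightarrow> int" where "z = (\<Sum>v\<in>\<sigma> ` I. of_int (u v) *\<^sub>R v)"
    using z module.span_finite[OF module_int_scale, of "\<sigma> ` I"] by (auto simp: zspan_def)
  then have zI: "z = (\<Sum>i\<in>I. of_int (u (\<sigma> i)) *\<^sub>R \<sigma> i)"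
    by (simp add: sum.reindex[OF inj])
  (* The coordinates of the difference of the two sums minus 2z, hence all zero. *)
  define k where "k i = (of_bool (i \<in> F) - of_bool (i \<in> J) - 2 * u (\<sigma> i) :: int)" for i
  have ind: "(\<Sum>r\<in>A. \<sigma> r) = (\<Sum>i\<in>I. of_int (of_bool (i \<in> A)) *\<^sub>R \<sigma> i)" if "A \<subseteq> I" for A
    using that \<open>finite I\<close> by (intro sum.mono_neutral_cong_left) auto
  have "(\<Sum>i\<in>I. of_int (k i) *\<^sub>R \<sigma> i) = 0"
  proof -
    have "(\<Sum>i\<in>I. of_int (k i) *\<^sub>R \<sigma> i) =
        (\<Sum>r\<in>F. \<sigma> r) - (\<Sum>r\<in>J. \<sigma> r) - 2 *\<^sub>R z"
      unfolding ind[OF \<open>F \<subseteq> I\<close>] ind[OF \<open>J \<subseteq> I\<close>] zI k_def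
      by (simp add: scaleR_sum_right scaleR_diff_left sum_subtractf)
    then show ?thesis using diff by simp
  qed
  then have "(\<Sum>v\<in>\<sigma> ` I. of_int (k (inv_into I \<sigma> v)) *\<^sub>R v) = 0"
    by (simp add: sum.reindex[OF inj] inj)
  then have k0: "k i = 0" if "i \<in> I" for i
    using module.independentD[OF module_int_scale indep \<open>finite (\<sigma> ` I)\<close> order_refl,
        of "\<lambda>v. k (inv_into I \<sigma> v)" "\<sigma> i"] that inj by simp
  have "i \<in> F \<longleftrightarrow> i \<in> J" if "i \<in> I" for i
    using k0[OF that] unfolding k_def by (cases "i \<in> F"; cases "i \<in> J"; simp; presburger)
  then show ?thesis using \<open>F \<subseteq> I\<close> \<open>J \<subseteq> I\<close> by blast
qed

text \<open>In the last case \<open>J\<close> must avoid the one unsupported set among itself and all its pairs.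
  Keeping a single element of that set out of \<open>J\<close> does this, and more than three indices leave
  room for it.\<close>

lemma pairwise_supported_Esupp:
  assumes basis: "zbasis_in I \<sigma> S" and "semilattice_set S" and "finite I"
    and "(\<exists>J\<in>Esupp I \<sigma> S. \<forall>r\<in>J. \<forall>s\<in>J. {r, s} \<in> supp I \<sigma> S) \<or>
      (3 \<le> card I \<and> is_lattice S) \<or>
      (3 < card I \<and> ind I \<sigma> S = 2 ^ card I - 2)"
  shows "\<exists>J\<in>Esupp I \<sigma> S. \<forall>r\<in>J. \<forall>s\<in>J. {r, s} \<in> supp I \<sigma> S"
  using assms(4)
proof (elim disjE conjE)
  assume "3 \<le> card I" and "is_lattice S"
  obtain J where J: "J \<subseteq> I" "card J = 3"
    using \<open>3 \<le> card I\<close> by (meson obtain_subset_with_card_n)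
  have "(\<Sum>r\<in>F. \<sigma> r) \<in> S" if "F \<subseteq> I" for F
  proof -
    have "(\<Sum>r\<in>F. \<sigma> r) \<in> zspan S"
      using basis that by (intro zspan_sum zspan_base) (auto simp: zbasis_in_def)
    then show ?thesis using \<open>is_lattice S\<close> by (simp add: is_lattice_def)
  qed
  then have sub: "F \<in> supp I \<sigma> S" if "F \<subseteq> I" for F
    using that by (simp add: supp_def)
  show ?thesis
  proof (intro bexI ballI)
    show "J \<in> Esupp I \<sigma> S" using sub[of J] J by (simp add: Esupp_def)
    show "{r, s} \<in> supp I \<sigma> S" if "r \<in> J" "s \<in> J" for r s
      using sub[of "{r, s}"] J that by blast
  qed
next
  assume "3 < card I" and ind: "ind I \<sigma> S = 2 ^ card I - 2"
  have sub: "supp I \<sigma> S \<subseteq> Pow I" by (auto simp: supp_def)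
  (* The size bound makes the truncated subtractions in ind harmless. *)
  have "(2::nat) ^ 4 \<le> 2 ^ card I" using \<open>3 < card I\<close> by (intro power_increasing) auto
  then have "card (supp I \<sigma> S) = 2 ^ card I - 1"
    using ind by (simp add: ind_def)
  then have "card (Pow I - supp I \<sigma> S) = 1"
    using sub \<open>finite I\<close> \<open>2 ^ 4 \<le> 2 ^ card I\<close>
    by (simp add: card_Diff_subset finite_subset card_Pow)
  then obtain J0 where J0: "Pow I - supp I \<sigma> S = {J0}"
    by (auto simp: card_1_singleton_iff)
  (* The empty set is supported, so the unsupported set J0 has an element p to avoid. *)
  have "{} \<in> supp I \<sigma> S"
    using \<open>semilattice_set S\<close> by (simp add: supp_def semilattice_set_def)
  then obtain p where "p \<in> J0" "p \<in> I" using J0 by blast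
  have "3 \<le> card (I - {p})" using \<open>3 < card I\<close> \<open>p \<in> I\<close> by simp
  then obtain J where J: "J \<subseteq> I - {p}" "card J = 3"
    by (meson obtain_subset_with_card_n)
  have sub: "F \<in> supp I \<sigma> S" if "F \<subseteq> I - {p}" for F
    using that J0 \<open>p \<in> J0\<close> by blast
  show ?thesis
  proof (intro bexI ballI)
    show "J \<in> Esupp I \<sigma> S" using sub[of J] J by (simp add: Esupp_def)
    show "{r, s} \<in> supp I \<sigma> S" if "r \<in> J" "s \<in> J" for r s
      using sub[of "{r, s}"] J that by blast
  qed
qed auto

text \<open>What keeps the roots with component \<open>0\<close>, \<open>\<sigma> r\<close> or \<open>\<sigma> r + \<sigma> s\<close> out of the removed
  orbit: three summands are needed for \<open>J\<close> to differ from every subset of size at most two.\<close>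

lemma small_sum_not_congruent:
  assumes "zbasis_in I \<sigma> S" and "finite I" and "J \<subseteq> I" "3 \<le> card J"
  shows "(\<Sum>r\<in>J. \<sigma> r) \<notin> (\<lambda>x. 2 *\<^sub>R x) ` zspan S"
    and "r \<in> J \<Longrightarrow> \<sigma> r - (\<Sum>r\<in>J. \<sigma> r) \<notin> (\<lambda>x. 2 *\<^sub>R x) ` zspan S"
    and "r \<in> J \<Longrightarrow> s \<in> J \<Longrightarrow> r \<noteq> s \<Longrightarrow>
      \<sigma> r + \<sigma> s - (\<Sum>r\<in>J. \<sigma> r) \<notin> (\<lambda>x. 2 *\<^sub>R x) ` zspan S"
proof -
  have neq: "(\<Sum>r\<in>F. \<sigma> r) - (\<Sum>r\<in>J. \<sigma> r) \<notin> (\<lambda>x. 2 *\<^sub>R x) ` zspan S"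
    if "F \<subseteq> J" "card F \<le> 2" for F
    using subset_sum_parity_unique[OF assms(1,2) subset_trans[OF that(1) assms(3)] assms(3)]
      that(2) assms(4) by auto
  show "(\<Sum>r\<in>J. \<sigma> r) \<notin> (\<lambda>x. 2 *\<^sub>R x) ` zspan S"
    using subset_sum_parity_unique[OF assms(1,2,3), of "{}"] assms(4) by auto
  show "\<sigma> r - (\<Sum>r\<in>J. \<sigma> r) \<notin> (\<lambda>x. 2 *\<^sub>R x) ` zspan S" if "r \<in> J"
    using neq[of "{r}"] that by simp
  show "\<sigma> r + \<sigma> s - (\<Sum>r\<in>J. \<sigma> r) \<notin> (\<lambda>x. 2 *\<^sub>R x) ` zspan S"
    if "r \<in> J" "s \<in> J" "r \<noteq> s"
    using neq[of "{r, s}"] that by simp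
qed

section \<open>Critical roots of the finite root systems\<close>

lemma inner_reflected_self:
  fixes \<beta> \<gamma> :: "'d::euclidean_space"
  assumes "\<gamma> \<noteq> 0"
  defines "\<beta>' \<equiv> \<beta> - (2 * (\<beta> \<bullet> \<gamma>) / (\<gamma> \<bullet> \<gamma>)) *\<^sub>R \<gamma>"
  shows "\<beta>' \<bullet> \<beta>' = \<beta> \<bullet> \<beta>"
  using assms by (simp add: inner_diff_left inner_diff_right inner_commute field_simps)

lemma reflected_short_root:
  assumes "finite_root_system \<Phi>" and "\<beta> \<in> short_roots \<Phi>" and "\<gamma> \<in> \<Phi> - {0}"
  shows "\<beta> - (2 * (\<beta> \<bullet> \<gamma>) / (\<gamma> \<bullet> \<gamma>)) *\<^sub>R \<gamma> \<in> short_roots \<Phi>"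
proof -
  define \<beta>' where "\<beta>' = \<beta> - (2 * (\<beta> \<bullet> \<gamma>) / (\<gamma> \<bullet> \<gamma>)) *\<^sub>R \<gamma>"
  have "\<beta> \<in> \<Phi> - {0}" using assms(2) by (simp add: short_roots_def)
  then have "\<beta>' \<in> \<Phi>"
    using assms(1,3) by (simp add: finite_root_system_def \<beta>'_def)
  moreover have same_norm: "\<beta>' \<bullet> \<beta>' = \<beta> \<bullet> \<beta>"
    using inner_reflected_self[of \<gamma> \<beta>] assms(3) by (simp add: \<beta>'_def)
  moreover have "\<beta>' \<noteq> 0"
    using same_norm \<open>\<beta> \<in> \<Phi> - {0}\<close> by auto
  ultimately have "\<beta>' \<in> short_roots \<Phi>"
    using assms(2) by (simp add: short_roots_def)
  then show ?thesis by (simp add: \<beta>'_def)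
qed

lemma reflected_long_root:
  assumes "finite_root_system \<Phi>" and "\<beta> \<in> long_roots \<Phi>" and "\<gamma> \<in> \<Phi> - {0}"
  shows "\<beta> - (2 * (\<beta> \<bullet> \<gamma>) / (\<gamma> \<bullet> \<gamma>)) *\<^sub>R \<gamma> \<in> long_roots \<Phi>"
proof -
  define \<beta>' where "\<beta>' = \<beta> - (2 * (\<beta> \<bullet> \<gamma>) / (\<gamma> \<bullet> \<gamma>)) *\<^sub>R \<gamma>"
  have "\<beta> \<in> \<Phi> - {0}" using assms(2) by (simp add: long_roots_def)
  then have "\<beta>' \<in> \<Phi>"
    using assms(1,3) by (simp add: finite_root_system_def \<beta>'_def)
  moreover have same_norm: "\<beta>' \<bullet> \<beta>' = \<beta> \<bullet> \<beta>"
    using inner_reflected_self[of \<gamma> \<beta>] assms(3) by (simp add: \<beta>'_def)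
  moreover have "\<beta>' \<noteq> 0"
    using same_norm \<open>\<beta> \<in> \<Phi> - {0}\<close> by auto
  ultimately have "\<beta>' \<in> long_roots \<Phi>"
    using assms(2) by (simp add: long_roots_def)
  then show ?thesis by (simp add: \<beta>'_def)
qed

text \<open>The short roots are the \<open>\<plusminus>e\<^sub>i\<close>, any two of which are orthogonal or proportional, so the
  Cartan integers between them are \<open>0\<close> and \<open>\<plusminus>2\<close>.\<close>

lemma typeB_short_roots:
  assumes "has_root_type TypeB l \<Phi>" and "1 \<le> l"
  shows "short_roots \<Phi> \<noteq> {}"
    and "\<beta> \<in> short_roots \<Phi> \<Longrightarrow> \<gamma> \<in> short_roots \<Phi> \<Longrightarrow>
      \<exists>k::int. 2 * (\<beta> \<bullet> \<gamma>) / (\<gamma> \<bullet> \<gamma>) = 2 * of_int k"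
proof -
  obtain e c where "c > 0"
    and orth: "\<forall>i\<in>{1..l}. \<forall>j\<in>{1..l}. e i \<bullet> e j = (if i = j then c else 0)"
    and \<Phi>: "\<Phi> = standard_roots TypeB l e"
    using assms(1) by (auto simp: has_root_type_def)
  have norms: "(\<alpha> \<bullet> \<alpha> = c \<and> (\<exists>a i. a \<in> {1, -1} \<and> i \<in> {1..l} \<and> \<alpha> = a *\<^sub>R e i)) \<or> \<alpha> \<bullet> \<alpha> = 2 * c"
    if "\<alpha> \<in> \<Phi> - {0}" for \<alpha>
  proof -
    have "\<alpha> \<in> {a *\<^sub>R e i | a i. a \<in> {1, -1} \<and> i \<in> {1..l}} \<union> pm_roots l e"
      using that by (simp add: \<Phi>)
    then consider a i where "a \<in> {1, -1}" "i \<in> {1..l}" "\<alpha> = a *\<^sub>R e i" | "\<alpha> \<in> pm_roots l e"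
      by blast
    then show ?thesis
    proof cases
      case 1
      then have "\<alpha> \<bullet> \<alpha> = c" using orth by auto
      then show ?thesis using 1 by blast
    next
      case 2
      then show ?thesis
        using orth by (auto simp: pm_roots_def inner_add_left inner_add_right inner_diff_left
            inner_diff_right)
    qed
  qed
  have e1: "e 1 \<in> \<Phi> - {0}" "e 1 \<bullet> e 1 = c"
  proof -
    show "e 1 \<bullet> e 1 = c" using orth assms(2) by auto
    then have "e 1 \<noteq> 0" using \<open>c > 0\<close> by auto
    moreover have "e 1 = 1 *\<^sub>R e 1" by simp
    then have "e 1 \<in> {a *\<^sub>R e i | a i. a \<in> {1, -1} \<and> i \<in> {1..l}}" using assms(2) by force
    ultimately show "e 1 \<in> \<Phi> - {0}" using \<Phi> by simp
  qed
  have "c \<le> \<alpha> \<bullet> \<alpha>" if "\<alpha> \<in> \<Phi> - {0}" for \<alpha>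
    using norms[OF that] \<open>c > 0\<close> by linarith
  then have "e 1 \<in> short_roots \<Phi>"
    unfolding short_roots_def mem_Collect_eq e1(2) using e1(1) by blast
  then show "short_roots \<Phi> \<noteq> {}" by blast
  have axis: "\<exists>a i. a \<in> {1, -1} \<and> i \<in> {1..l} \<and> \<alpha> = a *\<^sub>R e i"
    if "\<alpha> \<in> short_roots \<Phi>" for \<alpha>
  proof -
    have "\<alpha> \<in> \<Phi> - {0}" "\<alpha> \<bullet> \<alpha> \<le> c"
      using that e1 unfolding short_roots_def by (blast, metis (mono_tags, lifting) mem_Collect_eq)
    then have "\<alpha> \<bullet> \<alpha> \<noteq> 2 * c" using \<open>c > 0\<close> by linarith
    then show ?thesis using norms[OF \<open>\<alpha> \<in> \<Phi> - {0}\<close>] by blast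
  qed
  show "\<exists>k::int. 2 * (\<beta> \<bullet> \<gamma>) / (\<gamma> \<bullet> \<gamma>) = 2 * of_int k"
    if \<beta>: "\<beta> \<in> short_roots \<Phi>" and \<gamma>: "\<gamma> \<in> short_roots \<Phi>"
  proof -
    obtain a i where \<beta>: "a \<in> {1, -1}" "i \<in> {1..l}" "\<beta> = a *\<^sub>R e i" using axis[OF \<beta>] by blast
    obtain b j where \<gamma>: "b \<in> {1, -1}" "j \<in> {1..l}" "\<gamma> = b *\<^sub>R e j" using axis[OF \<gamma>] by blast
    have "\<beta> \<bullet> \<gamma> = a * b * (if i = j then c else 0)" "\<gamma> \<bullet> \<gamma> = c"
      using \<beta> \<gamma> orth by auto
    then have "2 * (\<beta> \<bullet> \<gamma>) / (\<gamma> \<bullet> \<gamma>) = 2 * of_int 1 \<or> 2 * (\<beta> \<bullet> \<gamma>) / (\<gamma> \<bullet> \<gamma>) = 2 * of_int 0 \<or>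
        2 * (\<beta> \<bullet> \<gamma>) / (\<gamma> \<bullet> \<gamma>) = 2 * of_int (-1)"
      using \<open>c > 0\<close> \<beta>(1) \<gamma>(1) by (auto split: if_splits)
    then show ?thesis by blast
  qed
qed

text \<open>The long roots are the \<open>\<plusminus>2e\<^sub>i\<close>.  The factor \<open>2\<close> makes their Cartan integers with all roots
  even; this is dual to the parity of the short roots in type \<open>B\<close>, but holds against
  roots of both lengths.\<close>

lemma typeC_long_roots:
  assumes "has_root_type TypeC l \<Phi>" and "1 \<le> l"
  shows "long_roots \<Phi> \<noteq> {}"
    and "\<beta> \<in> long_roots \<Phi> \<Longrightarrow> \<gamma> \<in> \<Phi> - {0} \<Longrightarrow>
      \<exists>k::int. 2 * (\<beta> \<bullet> \<gamma>) / (\<gamma> \<bullet> \<gamma>) = 2 * of_int k"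
proof -
  obtain e c where "c > 0"
    and orth: "\<forall>i\<in>{1..l}. \<forall>j\<in>{1..l}. e i \<bullet> e j = (if i = j then c else 0)"
    and \<Phi>: "\<Phi> = standard_roots TypeC l e"
    using assms(1) by (auto simp: has_root_type_def)
  have norms: "(\<alpha> \<bullet> \<alpha> = 4 * c \<and> (\<exists>a i. a \<in> {1, -1} \<and> i \<in> {1..l} \<and> \<alpha> = (2 * a) *\<^sub>R e i)) \<or>
      \<alpha> \<bullet> \<alpha> = 2 * c \<and> \<alpha> \<in> pm_roots l e"
    if "\<alpha> \<in> \<Phi> - {0}" for \<alpha>
  proof -
    have "\<alpha> \<in> {(2 * a) *\<^sub>R e i | a i. a \<in> {1, -1} \<and> i \<in> {1..l}} \<union> pm_roots l e"
      using that by (simp add: \<Phi>)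
    then consider a i where "a \<in> {1, -1}" "i \<in> {1..l}" "\<alpha> = (2 * a) *\<^sub>R e i" | "\<alpha> \<in> pm_roots l e"
      by blast
    then show ?thesis
    proof cases
      case 1
      then have "\<alpha> \<bullet> \<alpha> = 4 * c" using orth by auto
      then show ?thesis using 1 by blast
    next
      case 2
      then show ?thesis
        using orth by (auto simp: pm_roots_def inner_add_left inner_add_right inner_diff_left
            inner_diff_right)
    qed
  qed
  have e1: "2 *\<^sub>R e 1 \<in> \<Phi> - {0}" "2 *\<^sub>R e 1 \<bullet> 2 *\<^sub>R e 1 = 4 * c"
  proof -
    have "e 1 \<bullet> e 1 = c" using orth assms(2) by auto
    then show "2 *\<^sub>R e 1 \<bullet> 2 *\<^sub>R e 1 = 4 * c" by simp
    have "e 1 \<noteq> 0" using \<open>e 1 \<bullet> e 1 = c\<close> \<open>c > 0\<close> by auto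
    moreover have "2 *\<^sub>R e 1 = (2 * 1) *\<^sub>R e 1" by simp
    then have "2 *\<^sub>R e 1 \<in> {(2 * a) *\<^sub>R e i | a i. a \<in> {1, -1} \<and> i \<in> {1..l}}" using assms(2) by force
    ultimately show "2 *\<^sub>R e 1 \<in> \<Phi> - {0}" using \<Phi> by simp
  qed
  have "\<alpha> \<bullet> \<alpha> \<le> 4 * c" if "\<alpha> \<in> \<Phi> - {0}" for \<alpha>
    using norms[OF that] \<open>c > 0\<close> by linarith
  then have "2 *\<^sub>R e 1 \<in> long_roots \<Phi>"
    unfolding long_roots_def mem_Collect_eq e1(2) using e1(1) by blast
  then show "long_roots \<Phi> \<noteq> {}" by blast
  show "\<exists>k::int. 2 * (\<beta> \<bullet> \<gamma>) / (\<gamma> \<bullet> \<gamma>) = 2 * of_int k"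
    if \<beta>: "\<beta> \<in> long_roots \<Phi>" and \<gamma>: "\<gamma> \<in> \<Phi> - {0}"
  proof -
    have "\<beta> \<in> \<Phi> - {0}" "4 * c \<le> \<beta> \<bullet> \<beta>"
      using \<beta> e1 unfolding long_roots_def by (blast, metis (mono_tags, lifting) mem_Collect_eq)
    then obtain a i where \<beta>: "a \<in> {1, -1}" "i \<in> {1..l}" "\<beta> = (2 * a) *\<^sub>R e i"
      using norms[of \<beta>] \<open>c > 0\<close> by (smt (verit))
    from norms[OF \<gamma>]
    obtain k :: int where "(2 * a) * (e i \<bullet> \<gamma>) / (\<gamma> \<bullet> \<gamma>) = of_int k"
    proof (elim disjE conjE exE)
      fix b j assume \<gamma>: "\<gamma> \<bullet> \<gamma> = 4 * c" "b \<in> {1, -1}" "j \<in> {1..l}" "\<gamma> = (2 * b) *\<^sub>R e j"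
      then have "e i \<bullet> \<gamma> = 2 * b * (if i = j then c else 0)" using \<beta> orth by auto
      then have "(2 * a) * (e i \<bullet> \<gamma>) / (\<gamma> \<bullet> \<gamma>) = of_int 1 \<or>
          (2 * a) * (e i \<bullet> \<gamma>) / (\<gamma> \<bullet> \<gamma>) = of_int 0 \<or>
          (2 * a) * (e i \<bullet> \<gamma>) / (\<gamma> \<bullet> \<gamma>) = of_int (-1)"
        using \<open>c > 0\<close> \<beta>(1) \<gamma>(1,2) by (auto split: if_splits)
      then show thesis using that by blast
    next
      assume norm: "\<gamma> \<bullet> \<gamma> = 2 * c" and "\<gamma> \<in> pm_roots l e"
      then obtain p q b d where \<gamma>: "\<gamma> = b *\<^sub>R e p + d *\<^sub>R e q" "b \<in> {1, -1}" "d \<in> {1, -1}"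
        and pq: "1 \<le> p" "p < q" "q \<le> l"
        unfolding pm_roots_def by blast
      have pq': "p \<in> {1..l}" "q \<in> {1..l}" "p \<noteq> q" using pq by auto
      have "e i \<bullet> \<gamma> = b * (if i = p then c else 0) + d * (if i = q then c else 0)"
        using \<beta>(2) pq'(1,2) orth by (simp add: \<gamma>(1) inner_add_right)
      then have "(2 * a) * (e i \<bullet> \<gamma>) / (\<gamma> \<bullet> \<gamma>) = of_int 1 \<or>
          (2 * a) * (e i \<bullet> \<gamma>) / (\<gamma> \<bullet> \<gamma>) = of_int 0 \<or>
          (2 * a) * (e i \<bullet> \<gamma>) / (\<gamma> \<bullet> \<gamma>) = of_int (-1)"
        using \<open>c > 0\<close> \<beta>(1) \<gamma>(2,3) pq'(3) norm by (auto split: if_splits)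
      then show thesis using that by blast
    qed
    moreover have "2 * (\<beta> \<bullet> \<gamma>) / (\<gamma> \<bullet> \<gamma>) = 2 * ((2 * a) * (e i \<bullet> \<gamma>) / (\<gamma> \<bullet> \<gamma>))"
      by (simp add: \<beta>(3))
    ultimately have "2 * (\<beta> \<bullet> \<gamma>) / (\<gamma> \<bullet> \<gamma>) = 2 * of_int k" by (simp only:)
    then show ?thesis by blast
  qed
qed

section \<open>Non-minimal systems of type B and C\<close>

lemma nonisotropic_root_set:
  "nonisotropic (root_set \<Phi> S1 S2) =
    short_roots \<Phi> \<times> (S1 \<times> zspan S2) \<union> long_roots \<Phi> \<times> ((\<lambda>x. 2 *\<^sub>R x) ` zspan S1 \<times> S2)"
  by (auto simp: nonisotropic_def root_set_def V_form_def short_roots_def long_roots_def)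

lemma double_zspan:
  "0 \<in> (\<lambda>x. 2 *\<^sub>R x) ` zspan S"
  "a \<in> (\<lambda>x. 2 *\<^sub>R x) ` zspan S \<Longrightarrow> b \<in> (\<lambda>x. 2 *\<^sub>R x) ` zspan S \<Longrightarrow>
    a + b \<in> (\<lambda>x. 2 *\<^sub>R x) ` zspan S"
  "a \<in> (\<lambda>x. 2 *\<^sub>R x) ` zspan S \<Longrightarrow> - a \<in> (\<lambda>x. 2 *\<^sub>R x) ` zspan S"
  "x \<in> zspan S \<Longrightarrow> (2 * of_int k) *\<^sub>R x \<in> (\<lambda>x. 2 *\<^sub>R x) ` zspan S"
  "a \<in> (\<lambda>x. 2 *\<^sub>R x) ` zspan S \<Longrightarrow> of_int k *\<^sub>R a \<in> (\<lambda>x. 2 *\<^sub>R x) ` zspan S"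
proof -
  show "0 \<in> (\<lambda>x. 2 *\<^sub>R x) ` zspan S"
    using zspan_zero by (force intro: image_eqI[of _ _ 0])
  show "a + b \<in> (\<lambda>x. 2 *\<^sub>R x) ` zspan S"
    if "a \<in> (\<lambda>x. 2 *\<^sub>R x) ` zspan S" "b \<in> (\<lambda>x. 2 *\<^sub>R x) ` zspan S"
    using that zspan_add by (force simp flip: scaleR_add_right)
  show "- a \<in> (\<lambda>x. 2 *\<^sub>R x) ` zspan S" if "a \<in> (\<lambda>x. 2 *\<^sub>R x) ` zspan S"
    using that zspan_minus by (force simp flip: scaleR_minus_right)
  show scale: "(2 * of_int k) *\<^sub>R x \<in> (\<lambda>x. 2 *\<^sub>R x) ` zspan S" if "x \<in> zspan S" for x
    using zspan_scale[OF that, of k] by (auto intro!: image_eqI[of _ _ "of_int k *\<^sub>R x"])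
  show "of_int k *\<^sub>R a \<in> (\<lambda>x. 2 *\<^sub>R x) ` zspan S" if "a \<in> (\<lambda>x. 2 *\<^sub>R x) ` zspan S"
    using that scale by (auto simp: mult.commute)
qed

text \<open>The criterion with \<open>M = 2\<langle>S1\<rangle> \<times> \<langle>S2\<rangle>\<close>.  It absorbs the change under a short root
  because the Cartan integer is even, and under a long root because the first component of that
  root lies in \<open>2\<langle>S1\<rangle>\<close>.\<close>

lemma not_minimal_typeB:
  fixes S1 :: "'a::real_normed_vector set" and S2 :: "'b::real_normed_vector set"
  assumes type: "has_root_type TypeB l \<Phi>" and "1 \<le> l" and semi: "semilattice_set S1"
    and basis: "zbasis_in I \<sigma> S1" and "finite I"
    and J: "J \<in> Esupp I \<sigma> S1" "\<forall>r\<in>J. \<forall>s\<in>J. {r, s} \<in> supp I \<sigma> S1"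
  shows "\<not> minimal_ears (root_set \<Phi> S1 S2)"
proof -
  let ?D = "(\<lambda>x. 2 *\<^sub>R x) ` zspan S1"
  have J': "J \<subseteq> I" "3 \<le> card J" "(\<Sum>r\<in>J. \<sigma> r) \<in> S1"
    using J(1) by (auto simp: Esupp_def supp_def)
  have frs: "finite_root_system \<Phi>" using type by (simp add: has_root_type_def)
  have sum_x: "(\<Sum>r\<in>J. (\<sigma> r, 0)) = ((\<Sum>r\<in>J. \<sigma> r), 0 :: 'b)"
    by (simp add: prod_eq_iff fst_sum snd_sum)
  obtain e0 where "e0 \<in> short_roots \<Phi>" using typeB_short_roots(1)[OF type \<open>1 \<le> l\<close>] by blast
  note small = small_sum_not_congruent[OF basis \<open>finite I\<close> J'(1,2)]
  show ?thesis
  proof (rule not_minimal_if_class_removable[where E = "short_roots \<Phi>" and L = "S1 \<times> zspan S2"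
        and M = "?D \<times> zspan S2" and J = J and x = "\<lambda>r. (\<sigma> r, 0)", unfolded sum_x])
    show "short_roots \<Phi> \<times> (S1 \<times> zspan S2) \<subseteq> nonisotropic (root_set \<Phi> S1 S2)"
      by (auto simp: nonisotropic_root_set)
    show "e0 \<in> short_roots \<Phi>" by fact
    show "0 \<in> ?D \<times> zspan S2"
      by (simp add: zero_prod_def double_zspan zspan_zero)
    show "a + b \<in> ?D \<times> zspan S2" if "a \<in> ?D \<times> zspan S2" "b \<in> ?D \<times> zspan S2" for a b
      using that by (cases a; cases b) (simp add: double_zspan zspan_add)
    show "- a \<in> ?D \<times> zspan S2" if "a \<in> ?D \<times> zspan S2" for a
      using that by (cases a) (simp add: double_zspan zspan_minus)
    show "a + b \<in> S1 \<times> zspan S2" if "a \<in> S1 \<times> zspan S2" "b \<in> ?D \<times> zspan S2" for a b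
      using that by (cases a; cases b) (auto simp: semilattice_add_double[OF semi] zspan_add)
    show "finite J" using J'(1) \<open>finite I\<close> finite_subset by blast
    show "J \<noteq> {}" using J'(2) by auto
    show "((\<Sum>r\<in>J. \<sigma> r), 0) \<in> S1 \<times> zspan S2" using J'(3) zspan_zero by simp
    show "0 \<in> S1 \<times> zspan S2"
      using semi by (simp add: zero_prod_def zspan_zero semilattice_set_def)
    show "((\<Sum>r\<in>J. \<sigma> r), 0) \<notin> ?D \<times> zspan S2" using small(1) by simp
    show "(\<sigma> r, 0) \<in> S1 \<times> zspan S2 \<and> (\<sigma> r, 0) - ((\<Sum>r\<in>J. \<sigma> r), 0) \<notin> ?D \<times> zspan S2"
      if "r \<in> J" for r
      using small(2)[OF that] that J'(1) basis by (auto simp: zspan_zero zbasis_in_def)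
    show "(\<sigma> r, 0) + (\<sigma> s, 0) \<in> S1 \<times> zspan S2 \<and>
        (\<sigma> r, 0) + (\<sigma> s, 0) - ((\<Sum>r\<in>J. \<sigma> r), 0) \<notin> ?D \<times> zspan S2"
      if "r \<in> J" "s \<in> J" "r \<noteq> s" for r s
    proof -
      have "{r, s} \<in> supp I \<sigma> S1" using J(2) that by blast
      then have "\<sigma> r + \<sigma> s \<in> S1" using that by (simp add: supp_def)
      then show ?thesis using small(3)[OF that] by (simp add: zspan_zero)
    qed
    fix e \<gamma> assume e: "e \<in> short_roots \<Phi>" and \<gamma>: "\<gamma> \<in> nonisotropic (root_set \<Phi> S1 S2)"
    have \<gamma>\<Phi>: "fst \<gamma> \<in> \<Phi> - {0}"
      using \<gamma> by (auto simp: nonisotropic_root_set short_roots_def long_roots_def)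
    let ?n = "2 * (e \<bullet> fst \<gamma>) / (fst \<gamma> \<bullet> fst \<gamma>)"
    have "?n \<in> \<int>"
      using frs e \<gamma>\<Phi> by (simp add: finite_root_system_def short_roots_def)
    then obtain m :: int where m: "?n = of_int m" by (elim Ints_cases)
    have "?n *\<^sub>R snd \<gamma> \<in> ?D \<times> zspan S2"
    proof -
      obtain g p q where g: "\<gamma> = (g, (p, q))" by (metis prod.collapse)
      consider "g \<in> short_roots \<Phi>" "p \<in> S1" "q \<in> zspan S2" | "p \<in> ?D" "q \<in> S2"
        using \<gamma> by (auto simp: nonisotropic_root_set g)
      then show ?thesis
      proof cases
        case 1
        obtain k :: int where "?n = 2 * of_int k"
          using typeB_short_roots(2)[OF type \<open>1 \<le> l\<close> e 1(1)] by (auto simp: g)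
        then have "?n *\<^sub>R p \<in> ?D" using double_zspan(4)[OF zspan_base[OF 1(2)]] by metis
        moreover have "?n *\<^sub>R q \<in> zspan S2" unfolding m using zspan_scale[OF 1(3)] .
        ultimately show ?thesis by (simp add: g)
      next
        case 2
        have "?n *\<^sub>R p \<in> ?D" "?n *\<^sub>R q \<in> zspan S2"
          unfolding m using double_zspan(5)[OF 2(1)] zspan_scale[OF zspan_base[OF 2(2)]] by auto
        then show ?thesis by (simp add: g)
      qed
    qed
    then show "e - ?n *\<^sub>R fst \<gamma> \<in> short_roots \<Phi> \<and> ?n *\<^sub>R snd \<gamma> \<in> ?D \<times> zspan S2"
      using reflected_short_root[OF frs e \<gamma>\<Phi>] by blast
  qed
qed

text \<open>The criterion with \<open>M = 2\<langle>S1\<rangle> \<times> 2\<langle>S2\<rangle>\<close>, which absorbs every change because all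
  Cartan integers are even.\<close>

lemma not_minimal_typeC:
  fixes S1 :: "'a::real_normed_vector set" and S2 :: "'b::real_normed_vector set"
  assumes type: "has_root_type TypeC l \<Phi>" and "1 \<le> l" and semi: "semilattice_set S2"
    and basis: "zbasis_in I \<sigma> S2" and "finite I"
    and J: "J \<in> Esupp I \<sigma> S2" "\<forall>r\<in>J. \<forall>s\<in>J. {r, s} \<in> supp I \<sigma> S2"
  shows "\<not> minimal_ears (root_set \<Phi> S1 S2)"
proof -
  let ?D1 = "(\<lambda>x. 2 *\<^sub>R x) ` zspan S1" and ?D2 = "(\<lambda>x. 2 *\<^sub>R x) ` zspan S2"
  have J': "J \<subseteq> I" "3 \<le> card J" "(\<Sum>r\<in>J. \<sigma> r) \<in> S2"
    using J(1) by (auto simp: Esupp_def supp_def)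
  have frs: "finite_root_system \<Phi>" using type by (simp add: has_root_type_def)
  have sum_x: "(\<Sum>r\<in>J. (0, \<sigma> r)) = (0 :: 'a, (\<Sum>r\<in>J. \<sigma> r))"
    by (simp add: prod_eq_iff fst_sum snd_sum)
  obtain e0 where "e0 \<in> long_roots \<Phi>" using typeC_long_roots(1)[OF type \<open>1 \<le> l\<close>] by blast
  note small = small_sum_not_congruent[OF basis \<open>finite I\<close> J'(1,2)]
  show ?thesis
  proof (rule not_minimal_if_class_removable[where E = "long_roots \<Phi>" and L = "?D1 \<times> S2"
        and M = "?D1 \<times> ?D2" and J = J and x = "\<lambda>r. (0, \<sigma> r)", unfolded sum_x])
    show "long_roots \<Phi> \<times> (?D1 \<times> S2) \<subseteq> nonisotropic (root_set \<Phi> S1 S2)"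
      by (auto simp: nonisotropic_root_set)
    show "e0 \<in> long_roots \<Phi>" by fact
    show "0 \<in> ?D1 \<times> ?D2"
      by (simp add: zero_prod_def double_zspan)
    show "a + b \<in> ?D1 \<times> ?D2" if "a \<in> ?D1 \<times> ?D2" "b \<in> ?D1 \<times> ?D2" for a b
      using that by (cases a; cases b) (simp add: double_zspan)
    show "- a \<in> ?D1 \<times> ?D2" if "a \<in> ?D1 \<times> ?D2" for a
      using that by (cases a) (simp add: double_zspan)
    show "a + b \<in> ?D1 \<times> S2" if "a \<in> ?D1 \<times> S2" "b \<in> ?D1 \<times> ?D2" for a b
    proof -
      obtain p q p' z where ab: "a = (p, q)" "b = (p', 2 *\<^sub>R z)" "p \<in> ?D1" "q \<in> S2"
        "p' \<in> ?D1" "z \<in> zspan S2"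
        using \<open>a \<in> ?D1 \<times> S2\<close> \<open>b \<in> ?D1 \<times> ?D2\<close> by blast
      then show ?thesis
        using double_zspan(2)[OF ab(3,5)] semilattice_add_double[OF semi ab(6,4)] by simp
    qed
    show "finite J" using J'(1) \<open>finite I\<close> finite_subset by blast
    show "J \<noteq> {}" using J'(2) by auto
    show "(0, (\<Sum>r\<in>J. \<sigma> r)) \<in> ?D1 \<times> S2" using J'(3) double_zspan(1) by simp
    show "0 \<in> ?D1 \<times> S2"
      using semi by (simp add: zero_prod_def double_zspan(1) semilattice_set_def)
    show "(0, (\<Sum>r\<in>J. \<sigma> r)) \<notin> ?D1 \<times> ?D2" using small(1) by simp
    show "(0, \<sigma> r) \<in> ?D1 \<times> S2 \<and> (0, \<sigma> r) - (0, (\<Sum>r\<in>J. \<sigma> r)) \<notin> ?D1 \<times> ?D2"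
      if "r \<in> J" for r
    proof -
      have "\<sigma> r \<in> S2" using that J'(1) basis by (auto simp: zbasis_in_def)
      then show ?thesis using small(2)[OF that] double_zspan(1) by simp
    qed
    show "(0, \<sigma> r) + (0, \<sigma> s) \<in> ?D1 \<times> S2 \<and>
        (0, \<sigma> r) + (0, \<sigma> s) - (0, (\<Sum>r\<in>J. \<sigma> r)) \<notin> ?D1 \<times> ?D2"
      if "r \<in> J" "s \<in> J" "r \<noteq> s" for r s
    proof -
      have "{r, s} \<in> supp I \<sigma> S2" using J(2) that by blast
      then have "\<sigma> r + \<sigma> s \<in> S2" using that by (simp add: supp_def)
      then show ?thesis using small(3)[OF that] double_zspan(1) by simp
    qed
    fix e \<gamma> assume e: "e \<in> long_roots \<Phi>" and \<gamma>: "\<gamma> \<in> nonisotropic (root_set \<Phi> S1 S2)"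
    have \<gamma>\<Phi>: "fst \<gamma> \<in> \<Phi> - {0}"
      using \<gamma> by (auto simp: nonisotropic_root_set short_roots_def long_roots_def)
    let ?n = "2 * (e \<bullet> fst \<gamma>) / (fst \<gamma> \<bullet> fst \<gamma>)"
    obtain k :: int where k: "?n = 2 * of_int k"
      using typeC_long_roots(2)[OF type \<open>1 \<le> l\<close> e \<gamma>\<Phi>] by blast
    obtain g p q where g: "\<gamma> = (g, (p, q))" by (metis prod.collapse)
    have "p \<in> zspan S1" "q \<in> zspan S2"
      using \<gamma> zspan_base[of _ S1] zspan_base[of _ S2] zspan_scale[of _ S1 2]
      by (auto simp: nonisotropic_root_set g)
    then have "?n *\<^sub>R snd \<gamma> \<in> ?D1 \<times> ?D2"
      unfolding k using double_zspan(4)[of p S1 k] double_zspan(4)[of q S2 k] by (simp add: g)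
    then show "e - ?n *\<^sub>R fst \<gamma> \<in> long_roots \<Phi> \<and> ?n *\<^sub>R snd \<gamma> \<in> ?D1 \<times> ?D2"
      using reflected_long_root[OF frs e \<gamma>\<Phi>] by blast
  qed
qed

theorem corollary40:
  fixes X :: root_type and l \<nu> t :: nat
    and \<Phi> :: "'d::euclidean_space set"
    and S1 :: "'a::real_normed_vector set"
    and S2 :: "'b::real_normed_vector set"
    and \<sigma>1 :: "nat \<Rightarrow> 'a" and \<sigma>2 :: "nat \<Rightarrow> 'b"
  assumes ears: "reduced_ears X l \<nu> t \<Phi> S1 S2"
    and basis1: "zbasis_in {1..t} \<sigma>1 S1"
    and basis2: "zbasis_in {t+1..\<nu>} \<sigma>2 S2"
  shows
    "(X = TypeB \<and>
        ((\<exists>J\<in>Esupp {1..t} \<sigma>1 S1. \<forall>r\<in>J. \<forall>s\<in>J. {r, s} \<in> supp {1..t} \<sigma>1 S1) \<or>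
         (t \<ge> 3 \<and> is_lattice S1) \<or>
         (t > 3 \<and> ind {1..t} \<sigma>1 S1 = 2 ^ t - 2))
      \<longrightarrow> \<not> minimal_ears (root_set \<Phi> S1 S2)) \<and>
     (X = TypeC \<and>
        ((\<exists>J\<in>Esupp {t+1..\<nu>} \<sigma>2 S2. \<forall>r\<in>J. \<forall>s\<in>J. {r, s} \<in> supp {t+1..\<nu>} \<sigma>2 S2) \<or>
         (\<nu> - t \<ge> 3 \<and> is_lattice S2) \<or>
         (\<nu> - t > 3 \<and> ind {t+1..\<nu>} \<sigma>2 S2 = 2 ^ (\<nu> - t) - 2))
      \<longrightarrow> \<not> minimal_ears (root_set \<Phi> S1 S2))"
proof (intro conjI impI; elim conjE)
  interpret reduced_ears X l \<nu> t \<Phi> S1 S2 by (fact ears)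
  have "1 \<le> l" using rank by auto
  show "\<not> minimal_ears (root_set \<Phi> S1 S2)"
    if "X = TypeB"
      and cond: "(\<exists>J\<in>Esupp {1..t} \<sigma>1 S1. \<forall>r\<in>J. \<forall>s\<in>J. {r, s} \<in> supp {1..t} \<sigma>1 S1) \<or>
         (t \<ge> 3 \<and> is_lattice S1) \<or>
         (t > 3 \<and> ind {1..t} \<sigma>1 S1 = 2 ^ t - 2)"
  proof -
    obtain J where "J \<in> Esupp {1..t} \<sigma>1 S1" "\<forall>r\<in>J. \<forall>s\<in>J. {r, s} \<in> supp {1..t} \<sigma>1 S1"
      using pairwise_supported_Esupp[OF basis1 semilattice1] cond by auto
    then show ?thesis
      using not_minimal_typeB[OF _ \<open>1 \<le> l\<close> semilattice1 basis1] root_type \<open>X = TypeB\<close> by blast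
  qed
  show "\<not> minimal_ears (root_set \<Phi> S1 S2)"
    if "X = TypeC"
      and cond: "(\<exists>J\<in>Esupp {t+1..\<nu>} \<sigma>2 S2. \<forall>r\<in>J. \<forall>s\<in>J. {r, s} \<in> supp {t+1..\<nu>} \<sigma>2 S2) \<or>
         (\<nu> - t \<ge> 3 \<and> is_lattice S2) \<or>
         (\<nu> - t > 3 \<and> ind {t+1..\<nu>} \<sigma>2 S2 = 2 ^ (\<nu> - t) - 2)"
  proof -
    obtain J where "J \<in> Esupp {t+1..\<nu>} \<sigma>2 S2" "\<forall>r\<in>J. \<forall>s\<in>J. {r, s} \<in> supp {t+1..\<nu>} \<sigma>2 S2"
      using pairwise_supported_Esupp[OF basis2 semilattice2] cond by auto
    then show ?thesis
      using not_minimal_typeC[OF _ \<open>1 \<le> l\<close> semilattice2 basis2] root_type \<open>X = TypeC\<close> by blast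
  qed
qed

end
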